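(* Let $G$ be a twin-free finite simple graph with no isolated vertices such that $\det(G) = k \geq 2$. Then for every integer $t \geq k-1$, \[ \det(\mu^{(t)}(G)) = k, \quad \dist(\mu^{(t)}(G)) = 2, \quad \text{and} \quad \rho(\mu^{(t)}(G)) = k. \]
   Context: For $t \in \mathbb{N}$ and a graph $G$ with $V(G)=\{v_1,\dots,v_n\}$, the generalized Mycielskian $\mu^{(t)}(G)$ has vertex set $\{u_i^s : 1\le i\le n,\ 0\le s\le t\} \cup \{w\}$, with $u_i^0$ identified with $v_i$. For each edge $v_iv_j$ of $G$ it has edges $u_i^0u_j^0$ and $u_i^su_j^{s+1}$, $u_j^su_i^{s+1}$ for $0 \le s < t$; also edges $u_i^t w$ for $1 \le i \le n$; no other edges. A determining set of a graph $H$ is a vertex set $S$ such that the only automorphism fixing every vertex of $S$ is the identity; $\det(H)$ is the minimum size of one. A coloring of $V(H)$ with $d$ colors is distinguishing if only the identity automorphism preserves each color class; $\dist(H)$ is the least $d$ admitting a distinguishing $d$-coloring. If $\dist(H)=2$, the cost $\rho(H)$ is the minimum, over all distinguishing $2$-colorings, of the size of the smaller color class. Twins are vertices with equal open neighborhoods; twin-free means no pair of distinct twins. *)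

theory Defs
  imports "Graph_Theory.Pair_Digraph"
begin

(* Finite simple graphs are the library's pair_graph: a finite vertex set pverts and a symmetric,
   irreflexive relation parcs on it, so that an undirected edge is a pair of opposite arcs. *)

definition open_nbhd :: "'a pair_pre_digraph \<Rightarrow> 'a \<Rightarrow> 'a set" where
  "open_nbhd G v = {u \<in> pverts G. (v, u) \<in> parcs G}"

definition no_isolated_vertices :: "'a pair_pre_digraph \<Rightarrow> bool" where
  "no_isolated_vertices G \<longleftrightarrow> (\<forall>v \<in> pverts G. open_nbhd G v \<noteq> {})"

definition twin_free :: "'a pair_pre_digraph \<Rightarrow> bool" where
  "twin_free G \<longleftrightarrow>
     (\<forall>u \<in> pverts G. \<forall>v \<in> pverts G. u \<noteq> v \<longrightarrow> open_nbhd G u \<noteq> open_nbhd G v)"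

(* HOL functions are total: only the values on pverts are relevant, so being the identity
   is also a condition on pverts alone. *)

definition automorphism :: "'a pair_pre_digraph \<Rightarrow> ('a \<Rightarrow> 'a) \<Rightarrow> bool" where
  "automorphism G f \<longleftrightarrow>
     bij_betw f (pverts G) (pverts G) \<and>
     (\<forall>u \<in> pverts G. \<forall>v \<in> pverts G. (f u, f v) \<in> parcs G \<longleftrightarrow> (u, v) \<in> parcs G)"

definition determining_set :: "'a pair_pre_digraph \<Rightarrow> 'a set \<Rightarrow> bool" where
  "determining_set G S \<longleftrightarrow>
     S \<subseteq> pverts G \<and>
     (\<forall>f. automorphism G f \<and> (\<forall>v \<in> S. f v = v) \<longrightarrow> (\<forall>v \<in> pverts G. f v = v))"

(* In a finite graph the full vertex set is determining, and any injective coloring is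
   distinguishing, so the minima det_number and dist_number below are attained. *)

definition det_number :: "'a pair_pre_digraph \<Rightarrow> nat" where
  "det_number G = (LEAST n. \<exists>S. finite S \<and> determining_set G S \<and> card S = n)"

definition color_class :: "'a pair_pre_digraph \<Rightarrow> ('a \<Rightarrow> nat) \<Rightarrow> nat \<Rightarrow> 'a set" where
  "color_class G c i = {v \<in> pverts G. c v = i}"

(* The colors are 0, ..., d - 1; not all of them need to be used. *)

definition distinguishing_coloring :: "'a pair_pre_digraph \<Rightarrow> nat \<Rightarrow> ('a \<Rightarrow> nat) \<Rightarrow> bool" where
  "distinguishing_coloring G d c \<longleftrightarrow>
     (\<forall>v \<in> pverts G. c v < d) \<and>
     (\<forall>f. automorphism G f \<and> (\<forall>i < d. f ` color_class G c i = color_class G c i)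
        \<longrightarrow> (\<forall>v \<in> pverts G. f v = v))"

definition dist_number :: "'a pair_pre_digraph \<Rightarrow> nat" where
  "dist_number G = (LEAST d. \<exists>c. distinguishing_coloring G d c)"

(* Meaningful only for finite graphs with dist_number G = 2. *)

definition dist_cost :: "'a pair_pre_digraph \<Rightarrow> nat" where
  "dist_cost G =
     (LEAST m. \<exists>c. distinguishing_coloring G 2 c \<and>
        m = min (card (color_class G c 0)) (card (color_class G c 1)))"

(* Copy v s is the vertex u^s of the copy of v at level s (level 0 being the original graph),
   and Apex is w. *)

datatype 'a myc_vertex = Copy 'a nat | Apex

definition gen_mycielskian :: "nat \<Rightarrow> 'a pair_pre_digraph \<Rightarrow> 'a myc_vertex pair_pre_digraph" where
  "gen_mycielskian t G =
     \<lparr> pverts = {Copy v s | v s. v \<in> pverts G \<and> s \<le> t} \<union> {Apex},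
       parcs = {(Copy u 0, Copy v 0) | u v. (u, v) \<in> parcs G}
         \<union> {(Copy u s, Copy v (Suc s)) | u v s. (u, v) \<in> parcs G \<and> s < t}
         \<union> {(Copy u (Suc s), Copy v s) | u v s. (u, v) \<in> parcs G \<and> s < t}
         \<union> {(Copy v t, Apex) | v. v \<in> pverts G}
         \<union> {(Apex, Copy v t) | v. v \<in> pverts G} \<rparr>"

lemma pair_graph_gen_mycielskian:
  assumes "pair_graph G"
  shows "pair_graph (gen_mycielskian t G)"
proof -
  interpret pair_graph G by fact
  let ?M = "gen_mycielskian t G"
  have sym: "(v, u) \<in> parcs G" if "(u, v) \<in> parcs G" for u v
    using pair_sym_arcs that by (auto simp: symmetric_def dest: symD)
  have irr: "(u, u) \<notin> parcs G" for u
    using pair_no_loops by force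
  have "pverts ?M = (\<lambda>(v, s). Copy v s) ` (pverts G \<times> {..t}) \<union> {Apex}"
    by (auto simp: gen_mycielskian_def)
  then have fin: "finite (pverts ?M)"
    using pair_finite_verts by simp
  have sub: "parcs ?M \<subseteq> pverts ?M \<times> pverts ?M"
    by (auto simp: gen_mycielskian_def dest: in_arcsD1 in_arcsD2)
  have finarcs: "finite (parcs ?M)"
    using finite_subset[OF sub] fin by simp
  have "sym (parcs ?M)"
    by (rule symI) (auto simp: gen_mycielskian_def dest: sym)
  then have "symmetric (with_proj ?M)"
    by (simp add: symmetric_def)
  moreover have "fst e \<noteq> snd e" if "e \<in> parcs ?M" for e
    using that by (auto simp: gen_mycielskian_def irr)
  ultimately show ?thesis
    using fin finarcs sub by unfold_locales auto
qed

end

theory Submission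
  imports Defs
begin

text \<open>The apex \<open>w\<close> has an invariant property: every vertex \<open>y \<noteq> w\<close> that shares a neighbour with \<open>w\<close>
  shares exactly half of its own neighbours with \<open>w\<close>. If an automorphism moves \<open>w\<close> to a copy of
  \<open>i\<close>, this property forces every neighbour of \<open>i\<close> to be a leaf, so that by twin-freeness \<open>i\<close> has
  degree \<open>1\<close>; comparing degrees, \<open>G\<close> has two vertices and determining number at most \<open>1\<close>.
  Hence \<open>w\<close> is fixed, levels are preserved, and by twin-freeness every automorphism of the
  Mycielskian is a single automorphism of \<open>G\<close> acting on all levels at once. Placing the \<open>k\<close> elements
  of a minimum determining set on \<open>k\<close> different levels (there are \<open>t + 1 \<ge> k\<close>) gives a colour class of
  size \<open>k\<close> which determines everything, and no colour class of a distinguishing \<open>2\<close>-colouring can be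
  smaller, being itself a determining set.\<close>

section \<open>Neighbourhoods, automorphisms and determining sets of an arbitrary graph\<close>

lemma mem_open_nbhd_iff:
  assumes "pair_graph H"
  shows "u \<in> open_nbhd H v \<longleftrightarrow> (v, u) \<in> parcs H"
proof -
  interpret pair_graph H by fact
  show ?thesis by (auto simp: open_nbhd_def dest: in_arcsD2)
qed

lemma pair_graph_edgeD:
  assumes "pair_graph H" "(u, v) \<in> parcs H"
  shows "u \<in> pverts H" "v \<in> pverts H" "(v, u) \<in> parcs H" "u \<noteq> v"
proof -
  interpret pair_graph H by fact
  show "u \<in> pverts H" "v \<in> pverts H"
    using assms(2) by (auto dest: in_arcsD1 in_arcsD2)
  show "(v, u) \<in> parcs H"
    using pair_sym_arcs assms(2) by (auto simp: symmetric_def dest: symD)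
  show "u \<noteq> v"
    using pair_no_loops assms(2) by force
qed

lemma finite_pverts:
  assumes "pair_graph H"
  shows "finite (pverts H)"
proof -
  interpret pair_graph H by fact
  show ?thesis by (rule pair_finite_verts)
qed

lemma finite_open_nbhd: "pair_graph H \<Longrightarrow> finite (open_nbhd H v)"
  by (simp add: open_nbhd_def finite_pverts)

lemma open_nbhd_subset: "open_nbhd H v \<subseteq> pverts H"
  by (auto simp: open_nbhd_def)

lemma automorphism_in_pverts:
  "automorphism H f \<Longrightarrow> v \<in> pverts H \<Longrightarrow> f v \<in> pverts H"
  by (auto simp: automorphism_def bij_betw_def)

lemma automorphism_eq_iff:
  "automorphism H f \<Longrightarrow> u \<in> pverts H \<Longrightarrow> v \<in> pverts H \<Longrightarrow> f u = f v \<longleftrightarrow> u = v"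
  by (auto simp: automorphism_def bij_betw_def inj_on_eq_iff)

lemma automorphism_adj_iff:
  "automorphism H f \<Longrightarrow> u \<in> pverts H \<Longrightarrow> v \<in> pverts H \<Longrightarrow>
    (f u, f v) \<in> parcs H \<longleftrightarrow> (u, v) \<in> parcs H"
  by (auto simp: automorphism_def)

lemma automorphism_surj:
  assumes "automorphism H f" "v \<in> pverts H"
  obtains u where "u \<in> pverts H" "f u = v"
proof -
  have "v \<in> f ` pverts H"
    using assms by (simp add: automorphism_def bij_betw_def)
  with that show ?thesis by blast
qed

lemma automorphism_open_nbhd:
  assumes f: "automorphism H f" and v: "v \<in> pverts H"
  shows "open_nbhd H (f v) = f ` open_nbhd H v"
proof (intro set_eqI iffI)
  fix u assume u: "u \<in> open_nbhd H (f v)"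
  then have "u \<in> pverts H" by (simp add: open_nbhd_def)
  then obtain u' where "u' \<in> pverts H" "f u' = u"
    using automorphism_surj[OF f] by blast
  with u v show "u \<in> f ` open_nbhd H v"
    by (auto simp: open_nbhd_def automorphism_adj_iff[OF f])
qed (use f v in \<open>auto simp: open_nbhd_def automorphism_adj_iff automorphism_in_pverts\<close>)

lemma card_automorphism_image:
  assumes "automorphism H f" "S \<subseteq> pverts H"
  shows "card (f ` S) = card S"
  using assms by (auto simp: automorphism_def bij_betw_def intro: card_image inj_on_subset)

lemma automorphism_common_nbhd:
  assumes f: "automorphism H f" and "u \<in> pverts H" "v \<in> pverts H"
  shows "open_nbhd H (f u) \<inter> open_nbhd H (f v) = f ` (open_nbhd H u \<inter> open_nbhd H v)"
proof -
  have "inj_on f (pverts H)"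
    using f by (simp add: automorphism_def bij_betw_def)
  then show ?thesis
    using assms by (simp add: automorphism_open_nbhd inj_on_image_Int open_nbhd_subset)
qed

lemma determining_pverts: "determining_set H (pverts H)"
  by (simp add: determining_set_def)

lemma det_number_le:
  assumes "finite S" "determining_set H S"
  shows "det_number H \<le> card S"
  unfolding det_number_def by (rule Least_le) (use assms in blast)

lemma det_number_attained:
  assumes "pair_graph H"
  obtains S where "finite S" "determining_set H S" "card S = det_number H"
proof -
  have "\<exists>n S. finite S \<and> determining_set H S \<and> card S = n"
    using determining_pverts finite_pverts[OF assms] by blast
  then have "\<exists>S. finite S \<and> determining_set H S \<and> card S = det_number H"
    unfolding det_number_def by (rule LeastI_ex)
  with that show ?thesis by blast
qed

text \<open>The other class is the complement, so an automorphism that fixes one class pointwise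
  preserves both. This turns lower bounds on determining sets into lower bounds on the cost.\<close>

lemma determining_color_class:
  assumes c: "distinguishing_coloring H 2 c" and i: "i < 2"
  shows "determining_set H (color_class H c i)"
  unfolding determining_set_def
proof (intro conjI allI impI)
  show sub: "color_class H c i \<subseteq> pverts H"
    by (auto simp: color_class_def)
  fix f assume f: "automorphism H f \<and> (\<forall>v\<in>color_class H c i. f v = v)"
  then have bij: "inj_on f (pverts H)" "f ` pverts H = pverts H"
    by (auto simp: automorphism_def bij_betw_def)
  have fix_class: "f ` color_class H c i = color_class H c i"
    using f by simp
  have "f ` color_class H c j = color_class H c j" if "j < 2" for j
  proof (cases "j = i")
    case False
    have "\<forall>v\<in>pverts H. c v < 2"
      using c by (simp add: distinguishing_coloring_def)
    then have "color_class H c j = pverts H - color_class H c i"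
      using False that i by (auto simp: color_class_def less_2_cases_iff)
    then show ?thesis
      using inj_on_image_set_diff[OF bij(1) Diff_subset sub] bij(2) fix_class by simp
  qed (use fix_class in simp)
  with c f show "\<forall>v\<in>pverts H. f v = v"
    by (simp add: distinguishing_coloring_def)
qed

section \<open>Neighbourhoods and degrees in the Mycielskian\<close>

lemma pverts_gen_mycielskian:
  "x \<in> pverts (gen_mycielskian t G) \<longleftrightarrow>
    (case x of Copy v s \<Rightarrow> v \<in> pverts G \<and> s \<le> t | Apex \<Rightarrow> True)"
  by (auto simp: gen_mycielskian_def split: myc_vertex.splits)

lemma open_nbhd_Apex:
  "open_nbhd (gen_mycielskian t G) Apex = (\<lambda>v. Copy v t) ` pverts G"
  by (auto simp: gen_mycielskian_def open_nbhd_def)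

text \<open>Truncated subtraction puts the lower neighbours of level \<open>0\<close> on level \<open>0\<close> itself, so that
  level \<open>0\<close> needs no special treatment below.\<close>

lemma open_nbhd_Copy:
  assumes "pair_graph G" "v \<in> pverts G" "s \<le> t"
  shows "open_nbhd (gen_mycielskian t G) (Copy v s) =
    (\<lambda>u. Copy u (s - 1)) ` open_nbhd G v \<union>
    (if s < t then (\<lambda>u. Copy u (Suc s)) ` open_nbhd G v else {Apex})"
proof -
  note E = pair_graph_edgeD[OF assms(1)]
  show ?thesis
    using assms(2,3) E by (cases s) (auto simp: gen_mycielskian_def open_nbhd_def image_iff)
qed

lemma card_open_nbhd_Copy:
  assumes "pair_graph G" "v \<in> pverts G" "s \<le> t"
  shows "card (open_nbhd (gen_mycielskian t G) (Copy v s)) =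
    (if s < t then 2 * card (open_nbhd G v) else card (open_nbhd G v) + 1)"
proof -
  have inj: "inj_on (\<lambda>u. Copy u r) X" for r and X :: "'a set"
    by (auto intro: inj_onI)
  have fin: "finite (open_nbhd G v)"
    using assms(1) by (rule finite_open_nbhd)
  show ?thesis
  proof (cases "s < t")
    case True
    have "(\<lambda>u. Copy u (s - 1)) ` open_nbhd G v \<inter> (\<lambda>u. Copy u (Suc s)) ` open_nbhd G v = {}"
      by auto
    with True fin show ?thesis
      by (simp add: open_nbhd_Copy[OF assms] card_Un_disjoint card_image[OF inj])
  next
    case False
    with fin show ?thesis
      by (simp add: open_nbhd_Copy[OF assms] card_image[OF inj] image_iff)
  qed
qed

section \<open>The apex is fixed by every automorphism\<close>

lemma half_degree_Apex:
  fixes y :: "'a myc_vertex"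
  assumes G: "pair_graph G" and t: "t \<ge> 1"
  defines "M \<equiv> gen_mycielskian t G"
  assumes y: "y \<in> pverts M" "y \<noteq> Apex" and common: "open_nbhd M y \<inter> open_nbhd M Apex \<noteq> {}"
  shows "2 * card (open_nbhd M y \<inter> open_nbhd M Apex) = card (open_nbhd M y)"
proof -
  obtain v s where vs: "y = Copy v s" "v \<in> pverts G" "s \<le> t"
    using y by (cases y) (auto simp: M_def pverts_gen_mycielskian)
  \<comment> \<open>\<open>Apex\<close> sees only level \<open>t\<close>. Since
    \<open>t \<ge> 1\<close> gives \<open>s - 1 < t\<close>, a copy on level \<open>s\<close> meets
    level \<open>t\<close> only through its upper neighbours, which form half of its degree
    \<open>2 * card (open_nbhd G v)\<close>.\<close>
  have N: "open_nbhd M y \<inter> open_nbhd M Apex =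
      (if Suc s = t then (\<lambda>u. Copy u t) ` open_nbhd G v else {})"
    using t vs open_nbhd_subset[of G]
    by (auto simp: M_def open_nbhd_Copy[OF G] open_nbhd_Apex split: if_splits)
  with common have "Suc s = t"
    by (auto split: if_splits)
  then have "s < t" by simp
  have "card ((\<lambda>u. Copy u t) ` open_nbhd G v) = card (open_nbhd G v)"
    by (rule card_image) (auto intro: inj_onI)
  with N \<open>Suc s = t\<close> \<open>s < t\<close> vs show ?thesis
    using card_open_nbhd_Copy[OF G vs(2,3)] by (simp add: M_def)
qed

text \<open>Automorphisms preserve degrees and numbers of common neighbours, so an image of
  \<open>Apex\<close> inherits its property. This constrains a hypothetical image among the
  copies.\<close>

lemma half_degree_image_Apex:
  assumes G: "pair_graph G" and t: "t \<ge> 1"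
  defines "M \<equiv> gen_mycielskian t G"
  assumes f: "automorphism M f" and y: "y \<in> pverts M" "y \<noteq> f Apex"
    and common: "open_nbhd M y \<inter> open_nbhd M (f Apex) \<noteq> {}"
  shows "2 * card (open_nbhd M y \<inter> open_nbhd M (f Apex)) = card (open_nbhd M y)"
proof -
  have Apex: "Apex \<in> pverts M"
    by (simp add: M_def pverts_gen_mycielskian)
  obtain z where z: "z \<in> pverts M" "f z = y"
    using automorphism_surj[OF f y(1)] .
  have int: "open_nbhd M y \<inter> open_nbhd M (f Apex) = f ` (open_nbhd M z \<inter> open_nbhd M Apex)"
    using automorphism_common_nbhd[OF f z(1) Apex] z by simp
  have "2 * card (open_nbhd M z \<inter> open_nbhd M Apex) = card (open_nbhd M z)"
    using half_degree_Apex[OF G t] z y common int by (auto simp: M_def)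
  moreover have "card (open_nbhd M y \<inter> open_nbhd M (f Apex)) = card (open_nbhd M z \<inter> open_nbhd M Apex)"
    unfolding int by (rule card_automorphism_image[OF f]) (use open_nbhd_subset[of M] in blast)
  moreover have "card (open_nbhd M y) = card (open_nbhd M z)"
    using automorphism_open_nbhd[OF f z(1)] z card_automorphism_image[OF f open_nbhd_subset] by simp
  ultimately show ?thesis by simp
qed

lemma automorphism_fixes_Apex:
  assumes G: "pair_graph G" and tf: "twin_free G" and ni: "no_isolated_vertices G"
    and det: "det_number G \<ge> 2" and t: "t \<ge> 1"
    and f: "automorphism (gen_mycielskian t G) f"
  shows "f Apex = Apex"
proof (rule ccontr)
  let ?M = "gen_mycielskian t G"
  assume "f Apex \<noteq> Apex"
  have Apex: "Apex \<in> pverts ?M"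
    by (simp add: pverts_gen_mycielskian)
  with \<open>f Apex \<noteq> Apex\<close> obtain i s where x: "f Apex = Copy i s" "i \<in> pverts G" "s \<le> t"
    using automorphism_in_pverts[OF f Apex]
    by (cases "f Apex") (auto simp: pverts_gen_mycielskian)
  let ?d = "\<lambda>v. card (open_nbhd G v)"
  note E = pair_graph_edgeD[OF G] and N = mem_open_nbhd_iff[OF G]
  have inj: "inj_on (\<lambda>u. Copy u r) X" for r and X :: "'a set"
    by (auto intro: inj_onI)
  have nbr_i: "l = i" if j: "(i, j) \<in> parcs G" and l: "(j, l) \<in> parcs G" for j l
  proof (rule ccontr)
    assume "l \<noteq> i"
    have lV: "l \<in> pverts G" using E l by blast
    define C where "C = open_nbhd G l \<inter> open_nbhd G i"
    have finC: "finite C" using finite_open_nbhd[OF G] by (simp add: C_def)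
    have "j \<in> C" using j l E by (simp add: C_def N)
    then have C: "card C > 0" using finC by (auto simp: card_gt_0_iff)
    \<comment> \<open>\<open>r\<close> is two levels below \<open>s\<close>, with level \<open>- m - 1\<close> folded back onto level \<open>m\<close>: the copies
      \<open>Copy l r\<close> and \<open>Copy i s\<close> then share exactly the vertices of \<open>C\<close> on the level in between.
      Halving the degrees of \<open>Copy l r\<close> and \<open>Copy l s\<close> gives incompatible values for \<open>card C\<close>.\<close>
    define r where "r = (if s = 0 then 1 else s - 2)"
    have r: "r \<le> t" "r \<noteq> s" using x t by (auto simp: r_def)
    have int_r: "open_nbhd ?M (Copy l r) \<inter> open_nbhd ?M (Copy i s) = (\<lambda>u. Copy u (s - 1)) ` C"
      unfolding open_nbhd_Copy[OF G lV r(1)] open_nbhd_Copy[OF G x(2,3)]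
    proof -
      consider "s = 0" | "s = 1" | p where "s = Suc (Suc p)"
        by (metis One_nat_def not0_implies_Suc)
      then show "((\<lambda>u. Copy u (r - 1)) ` open_nbhd G l \<union>
          (if r < t then (\<lambda>u. Copy u (Suc r)) ` open_nbhd G l else {Apex})) \<inter>
        ((\<lambda>u. Copy u (s - 1)) ` open_nbhd G i \<union>
          (if s < t then (\<lambda>u. Copy u (Suc s)) ` open_nbhd G i else {Apex})) =
        (\<lambda>u. Copy u (s - 1)) ` C"
        by cases (use x(3) t in \<open>auto simp: C_def r_def split: if_splits\<close>)
    qed
    have "2 * card ((\<lambda>u. Copy u (s - 1)) ` C) = card (open_nbhd ?M (Copy l r))"
      using half_degree_image_Apex[OF G t f, of "Copy l r"] r lV x int_r \<open>j \<in> C\<close>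
      by (auto simp: pverts_gen_mycielskian)
    then have 1: "2 * card C = (if r < t then 2 * ?d l else ?d l + 1)"
      by (simp add: card_image[OF inj] card_open_nbhd_Copy[OF G lV r(1)])
    have int_s: "open_nbhd ?M (Copy l s) \<inter> open_nbhd ?M (Copy i s) =
        (\<lambda>u. Copy u (s - 1)) ` C \<union> (if s < t then (\<lambda>u. Copy u (Suc s)) ` C else {Apex})"
      by (auto simp: open_nbhd_Copy[OF G lV x(3)] open_nbhd_Copy[OF G x(2,3)] C_def image_iff
          split: if_splits)
    have card_s: "card (open_nbhd ?M (Copy l s) \<inter> open_nbhd ?M (Copy i s)) =
        (if s < t then 2 * card C else card C + 1)"
    proof (cases "s < t")
      case True
      have "(\<lambda>u. Copy u (s - 1)) ` C \<inter> (\<lambda>u. Copy u (Suc s)) ` C = {}" by auto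
      with True finC show ?thesis
        unfolding int_s by (simp add: card_Un_disjoint card_image[OF inj])
    qed (use finC in \<open>simp add: int_s card_image[OF inj] image_iff\<close>)
    \<comment> \<open>The levels agree here, so \<open>l \<noteq> i\<close> is what separates
      \<open>Copy l s\<close> from \<open>f Apex\<close>; for \<open>Copy l r\<close> it was
      \<open>r \<noteq> s\<close>.\<close>
    have "2 * card (open_nbhd ?M (Copy l s) \<inter> open_nbhd ?M (Copy i s)) =
        card (open_nbhd ?M (Copy l s))"
      using half_degree_image_Apex[OF G t f, of "Copy l s"] lV x int_s \<open>j \<in> C\<close> \<open>l \<noteq> i\<close>
      by (simp add: pverts_gen_mycielskian) fastforce
    then have 2: "2 * (if s < t then 2 * card C else card C + 1) =
        (if s < t then 2 * ?d l else ?d l + 1)"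
      by (simp add: card_s card_open_nbhd_Copy[OF G lV x(3)])
    \<comment> \<open>Write \<open>c\<close> for \<open>card C\<close> and \<open>d\<close> for
      \<open>?d l\<close>. If \<open>s < t\<close>, then \<open>d = 2 * c\<close>, against both
      \<open>c = d\<close> and \<open>2 * c = d + 1\<close>, as \<open>c > 0\<close>. If
      \<open>s = t\<close>, then \<open>r < t\<close>, so \<open>c = d\<close>, against
      \<open>2 * (c + 1) = d + 1\<close>.\<close>
    show False
      using 1 2 C x(3) r by (auto split: if_splits)
  qed
  obtain j where j: "(i, j) \<in> parcs G"
    using ni x(2) N unfolding no_isolated_vertices_def by blast
  \<comment> \<open>All neighbours of \<open>i\<close> have the open neighbourhood
    \<open>{i}\<close>, so two different ones would be twins.\<close>
  have "j' = j" if j': "(i, j') \<in> parcs G" for j'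
  proof -
    have "open_nbhd G p = {i}" if "(i, p) \<in> parcs G" for p
      using nbr_i[OF that] E(3)[OF that] unfolding set_eq_iff N by blast
    then have "open_nbhd G j' = open_nbhd G j"
      using j j' by simp
    then show ?thesis
      using tf E(2)[OF j] E(2)[OF j'] unfolding twin_free_def by metis
  qed
  then have Ni: "open_nbhd G i = {j}"
    using j unfolding set_eq_iff N by blast
  \<comment> \<open>As \<open>i\<close> has degree 1, \<open>Copy i s\<close> has degree 2 on every
    level, the top one included, while the degree of \<open>Apex\<close> is the order of
    \<open>G\<close>.\<close>
  have "card (open_nbhd ?M (f Apex)) = card (open_nbhd ?M Apex)"
    using automorphism_open_nbhd[OF f Apex] card_automorphism_image[OF f open_nbhd_subset] by simp
  then have "card (pverts G) = 2"
    by (simp add: x(1) card_open_nbhd_Copy[OF G x(2,3)] Ni open_nbhd_Apex card_image[OF inj]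
        split: if_splits)
  then have V: "pverts G = {i, j}"
    using j E[OF j] card_seteq[of "pverts G" "{i, j}"] finite_pverts[OF G] by auto
  have "determining_set G {i}"
    using V E(4)[OF j] by (auto simp: determining_set_def automorphism_def bij_betw_def)
  then have "det_number G \<le> 1"
    using det_number_le[of "{i}" G] by simp
  with det show False by simp
qed

section \<open>Automorphisms of the Mycielskian come from automorphisms of \<open>G\<close>\<close>

lemma automorphism_level:
  assumes G: "pair_graph G" and ni: "no_isolated_vertices G"
    and f: "automorphism (gen_mycielskian t G) f" and w: "f Apex = Apex" and "s \<le> t"
  shows "f ` (\<lambda>v. Copy v s) ` pverts G = (\<lambda>v. Copy v s) ` pverts G"
  using \<open>s \<le> t\<close>
\<comment> \<open>Downward induction from level \<open>t\<close>, the neighbourhood of the fixed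
  apex. The step for \<open>s\<close> uses both \<open>s + 1\<close> and \<open>s + 2\<close>, hence
  \<open>less_induct\<close>.\<close>
proof (induction "t - s" arbitrary: s rule: less_induct)
  case less
  let ?M = "gen_mycielskian t G" and ?L = "\<lambda>s. (\<lambda>v. Copy v s) ` pverts G"
  have Apex: "Apex \<in> pverts ?M"
    by (simp add: pverts_gen_mycielskian)
  have L: "?L r \<subseteq> pverts ?M" if "r \<le> t" for r
    using that by (auto simp: pverts_gen_mycielskian)
  show ?case
  proof (cases "s = t")
    case True
    then show ?thesis
      using automorphism_open_nbhd[OF f Apex] by (simp add: w open_nbhd_Apex)
  next
    case False
    with less.prems have s: "s < t" by simp
    have "f ` ?L s \<subseteq> ?L s"
    proof clarify
      fix v assume v: "v \<in> pverts G"
      let ?x = "Copy v s"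
      have x: "?x \<in> pverts ?M" using v s by (simp add: pverts_gen_mycielskian)
      obtain u where u: "u \<in> open_nbhd G v"
        using ni v by (auto simp: no_isolated_vertices_def)
      then have uV: "u \<in> pverts G" using open_nbhd_subset[of G v] by blast
      have "v \<in> open_nbhd G u"
        using u pair_graph_edgeD(3)[OF G] by (simp add: mem_open_nbhd_iff[OF G])
      then have "?x \<in> open_nbhd ?M (Copy u (Suc s))"
        using s by (simp add: open_nbhd_Copy[OF G uV])
      moreover have "Copy u (Suc s) \<in> pverts ?M"
        using s uV by (simp add: pverts_gen_mycielskian)
      ultimately have fx: "f ?x \<in> open_nbhd ?M (f (Copy u (Suc s)))"
        using automorphism_open_nbhd[OF f] by blast
      have "f (Copy u (Suc s)) \<in> ?L (Suc s)"
        using less.hyps[of "Suc s"] s uV by (metis Suc_leI diff_less_mono2 image_eqI lessI)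
      then obtain p where p: "p \<in> pverts G" "f (Copy u (Suc s)) = Copy p (Suc s)"
        by blast
      \<comment> \<open>A neighbour of \<open>Copy p (Suc s)\<close> lies on level \<open>s\<close>
        or \<open>s + 2\<close>, or is \<open>Apex\<close>. The last two are excluded by
        injectivity: \<open>Apex\<close> and level \<open>s + 2\<close> are already mapped onto
        themselves.\<close>
      have "f ?x \<noteq> Apex"
        using automorphism_eq_iff[OF f x Apex] w by simp
      moreover have "f ?x \<notin> ?L (Suc (Suc s))" if s': "Suc s < t"
      proof
        assume "f ?x \<in> ?L (Suc (Suc s))"
        then have "f ?x \<in> f ` ?L (Suc (Suc s))"
          using less.hyps[of "Suc (Suc s)"] s' by simp
        then show False
          using automorphism_eq_iff[OF f x] L[of "Suc (Suc s)"] s' by fastforce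
      qed
      ultimately show "f ?x \<in> ?L s"
        using fx s open_nbhd_subset[of G p] unfolding p(2)
        by (auto simp: open_nbhd_Copy[OF G p(1)] split: if_splits)
    qed
    moreover have "inj_on f (?L s)"
      using f L[of s] s by (auto simp: automorphism_def bij_betw_def intro: inj_on_subset)
    ultimately show ?thesis
      by (intro endo_inj_surj finite_imageI finite_pverts[OF G])
  qed
qed

lemma automorphism_gen_mycielskian_imp_lift:
  assumes G: "pair_graph G" and tf: "twin_free G" and ni: "no_isolated_vertices G"
    and f: "automorphism (gen_mycielskian t G) f" and w: "f Apex = Apex"
  obtains \<alpha> where "automorphism G \<alpha>"
    "\<And>v s. v \<in> pverts G \<Longrightarrow> s \<le> t \<Longrightarrow> f (Copy v s) = Copy (\<alpha> v) s"
proof -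
  let ?M = "gen_mycielskian t G"
  note level = automorphism_level[OF G ni f w]
  have M: "Copy v s \<in> pverts ?M" if "v \<in> pverts G" "s \<le> t" for v s
    using that by (simp add: pverts_gen_mycielskian)
  have "\<exists>\<beta>. \<forall>v\<in>pverts G. \<beta> v \<in> pverts G \<and> f (Copy v 0) = Copy (\<beta> v) 0"
    using level[of 0] by (intro bchoice) blast
  then obtain \<alpha> where \<alpha>: "\<And>v. v \<in> pverts G \<Longrightarrow> \<alpha> v \<in> pverts G"
      "\<And>v. v \<in> pverts G \<Longrightarrow> f (Copy v 0) = Copy (\<alpha> v) 0"
    by blast
  have adj0: "(Copy u 0, Copy v 0) \<in> parcs ?M \<longleftrightarrow> (u, v) \<in> parcs G" for u v
    by (auto simp: gen_mycielskian_def)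
  have adjS: "(Copy u (Suc s), Copy v s) \<in> parcs ?M \<longleftrightarrow> (u, v) \<in> parcs G" if "s < t" for u v s
    using that by (auto simp: gen_mycielskian_def)
  have "inj_on \<alpha> (pverts G)"
    using automorphism_eq_iff[OF f M M] \<alpha> by (auto intro!: inj_onI) (metis myc_vertex.inject zero_le)
  moreover from this have "\<alpha> ` pverts G = pverts G"
    using endo_inj_surj[OF finite_pverts[OF G]] \<alpha>(1) by blast
  ultimately have "bij_betw \<alpha> (pverts G) (pverts G)"
    by (simp add: bij_betw_def)
  moreover have "(\<alpha> u, \<alpha> v) \<in> parcs G \<longleftrightarrow> (u, v) \<in> parcs G"
    if "u \<in> pverts G" "v \<in> pverts G" for u v
    using that automorphism_adj_iff[OF f M[OF that(1) le0] M[OF that(2) le0]] \<alpha>(2) adj0 by simp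
  ultimately have aut: "automorphism G \<alpha>"
    by (simp add: automorphism_def)
  have "f (Copy v s) = Copy (\<alpha> v) s" if "v \<in> pverts G" "s \<le> t" for v s
    using that
  proof (induction s arbitrary: v)
    case (Suc s)
    obtain v' where v': "v' \<in> pverts G" "f (Copy v (Suc s)) = Copy v' (Suc s)"
      using level[OF Suc.prems(2)] Suc.prems(1) by blast
    \<comment> \<open>Adjacency to level \<open>s\<close>, where \<open>f\<close> already acts as
      \<open>\<alpha>\<close>, determines the vertex on level \<open>s + 1\<close>: since
      \<open>\<alpha>\<close> is onto, \<open>v'\<close> and \<open>\<alpha> v\<close> have equal
      neighbourhoods.\<close>
    have "(v', \<alpha> p) \<in> parcs G \<longleftrightarrow> (\<alpha> v, \<alpha> p) \<in> parcs G" if p: "p \<in> pverts G" for p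
    proof -
      have "(v', \<alpha> p) \<in> parcs G \<longleftrightarrow> (f (Copy v (Suc s)), f (Copy p s)) \<in> parcs ?M"
        using Suc v' p adjS by simp
      also have "\<dots> \<longleftrightarrow> (v, p) \<in> parcs G"
        using Suc.prems p automorphism_adj_iff[OF f M M] adjS by simp
      also have "\<dots> \<longleftrightarrow> (\<alpha> v, \<alpha> p) \<in> parcs G"
        using Suc.prems p automorphism_adj_iff[OF aut] by simp
      finally show ?thesis .
    qed
    then have "open_nbhd G v' = open_nbhd G (\<alpha> v)"
      using automorphism_surj[OF aut] unfolding open_nbhd_def by blast
    then have "v' = \<alpha> v"
      using tf v'(1) \<alpha>(1) Suc.prems by (auto simp: twin_free_def)
    with v' show ?case by simp
  qed (use \<alpha> in simp)
  with aut that show ?thesis by blast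
qed

section \<open>Lower bound: determining sets project from the Mycielskian to
  \<open>G\<close>\<close>

lemma automorphism_lift:
  assumes G: "pair_graph G" and \<alpha>: "automorphism G \<alpha>"
  shows "automorphism (gen_mycielskian t G) (case_myc_vertex (\<lambda>v s. Copy (\<alpha> v) s) Apex)"
    (is "automorphism ?M ?f")
proof -
  have inj: "inj_on ?f (pverts ?M)"
    using automorphism_eq_iff[OF \<alpha>]
    by (auto simp: pverts_gen_mycielskian intro!: inj_onI split: myc_vertex.splits)
  have "?f ` pverts ?M \<subseteq> pverts ?M"
    using automorphism_in_pverts[OF \<alpha>]
    by (auto simp: pverts_gen_mycielskian split: myc_vertex.splits)
  then have "bij_betw ?f (pverts ?M) (pverts ?M)"
    using inj endo_inj_surj[OF finite_pverts[OF pair_graph_gen_mycielskian[OF G]]]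
    by (auto simp: bij_betw_def)
  moreover have "(?f x, ?f y) \<in> parcs ?M \<longleftrightarrow> (x, y) \<in> parcs ?M"
    if "x \<in> pverts ?M" "y \<in> pverts ?M" for x y
    using that automorphism_adj_iff[OF \<alpha>] automorphism_in_pverts[OF \<alpha>]
    by (cases x; cases y) (auto simp: gen_mycielskian_def)
  ultimately show ?thesis
    by (simp add: automorphism_def)
qed

text \<open>An automorphism of \<open>G\<close> that fixes the projection lifts to one that fixes
  \<open>T\<close>, hence to the identity; level 0 then gives back the identity on
  \<open>G\<close>.\<close>

lemma determining_set_project:
  assumes G: "pair_graph G" and T: "determining_set (gen_mycielskian t G) T"
  shows "determining_set G {v. \<exists>s. Copy v s \<in> T}"
  unfolding determining_set_def
proof (intro conjI allI impI)
  let ?M = "gen_mycielskian t G"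
  have "T \<subseteq> pverts ?M"
    using T by (simp add: determining_set_def)
  then show "{v. \<exists>s. Copy v s \<in> T} \<subseteq> pverts G"
    by (auto simp: pverts_gen_mycielskian)
  fix \<alpha> assume \<alpha>: "automorphism G \<alpha> \<and> (\<forall>v\<in>{v. \<exists>s. Copy v s \<in> T}. \<alpha> v = v)"
  let ?f = "case_myc_vertex (\<lambda>v s. Copy (\<alpha> v) s) Apex"
  have "\<forall>x\<in>T. ?f x = x"
    using \<alpha> by (auto split: myc_vertex.splits)
  then have "\<forall>x\<in>pverts ?M. ?f x = x"
    using T automorphism_lift[OF G] \<alpha> unfolding determining_set_def by blast
  then show "\<forall>v\<in>pverts G. \<alpha> v = v"
    by (auto simp: pverts_gen_mycielskian dest!: bspec[where x = "Copy _ 0"])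
qed

lemma det_number_le_gen_mycielskian:
  assumes "pair_graph G"
  shows "det_number G \<le> det_number (gen_mycielskian t G)"
proof -
  obtain T where T: "finite T" "determining_set (gen_mycielskian t G) T"
    "card T = det_number (gen_mycielskian t G)"
    using det_number_attained[OF pair_graph_gen_mycielskian[OF assms]] .
  let ?S = "{v. \<exists>s. Copy v s \<in> T}"
  \<comment> \<open>\<open>T\<close> may contain \<open>Apex\<close>, which has no projection; its
    value \<open>undefined\<close> is harmless, since an inclusion suffices to bound the
    cardinality.\<close>
  have sub: "?S \<subseteq> case_myc_vertex (\<lambda>v s. v) undefined ` T"
    by force
  then have "card ?S \<le> card T" "finite ?S"
    using T(1) surj_card_le finite_surj by blast+
  then show ?thesis
    using det_number_le[OF _ determining_set_project[OF assms T(2)]] T(3) by simp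
qed

section \<open>The three invariants, from \<open>k\<close> vertices on distinct levels\<close>

theorem theorem4:
  fixes G :: "'a pair_pre_digraph" and k t :: nat
  assumes "pair_graph G"
    and "twin_free G"
    and "no_isolated_vertices G"
    and "det_number G = k"
    and "k \<ge> 2"
    and "t \<ge> k - 1"
  shows "det_number (gen_mycielskian t G) = k
    \<and> dist_number (gen_mycielskian t G) = 2
    \<and> dist_cost (gen_mycielskian t G) = k"
proof -
  let ?M = "gen_mycielskian t G"
  note G = assms(1)
  have M: "pair_graph ?M"
    using G by (rule pair_graph_gen_mycielskian)
  obtain S where S: "finite S" "determining_set G S" "card S = k"
    using det_number_attained[OF G] unfolding assms(4) by blast
  \<comment> \<open>\<open>\<sigma>\<close> chooses a level for each element of \<open>S\<close>.
    The values \<open>0, ..., k - 1\<close> are available because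
    \<open>k - 1 \<le> t\<close>.\<close>
  obtain \<sigma> where "bij_betw \<sigma> S {0..<k}"
    using ex_bij_betw_finite_nat[OF S(1)] S(3) by blast
  then have \<sigma>: "inj_on \<sigma> S" "\<And>v. v \<in> S \<Longrightarrow> \<sigma> v \<le> t"
    using bij_betwE[of \<sigma> S "{0..<k}"] bij_betw_imp_inj_on[of \<sigma> S "{0..<k}"] assms(6)
    by fastforce+
  have SV: "S \<subseteq> pverts G"
    using S(2) by (simp add: determining_set_def)
  define T where "T = (\<lambda>v. Copy v (\<sigma> v)) ` S"
  have cardT: "card T = k" and finT: "finite T"
    using S unfolding T_def by (auto simp: card_image inj_on_def)
  have TM: "T \<subseteq> pverts ?M"
    using SV \<sigma>(2) by (auto simp: T_def pverts_gen_mycielskian)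
  \<comment> \<open>The elements of \<open>T\<close> lie on pairwise different levels, so an automorphism that preserves
    \<open>T\<close> as a set fixes it pointwise.\<close>
  have rigid: "\<forall>x\<in>pverts ?M. f x = x" if f: "automorphism ?M f" and fT: "f ` T \<subseteq> T" for f
  proof -
    have w: "f Apex = Apex"
      using automorphism_fixes_Apex[OF G assms(2,3) _ _ f] assms by simp
    obtain \<alpha> where \<alpha>: "automorphism G \<alpha>"
      "\<And>v s. v \<in> pverts G \<Longrightarrow> s \<le> t \<Longrightarrow> f (Copy v s) = Copy (\<alpha> v) s"
      using automorphism_gen_mycielskian_imp_lift[OF G assms(2,3) f w] by blast
    have "\<alpha> v = v" if v: "v \<in> S" for v
    proof -
      have "Copy (\<alpha> v) (\<sigma> v) \<in> T"
        using fT v \<alpha>(2)[of v "\<sigma> v"] SV \<sigma>(2) by (force simp: T_def)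
      then show ?thesis
        using \<sigma>(1) v by (auto simp: T_def inj_on_def)
    qed
    then have "\<forall>v\<in>pverts G. \<alpha> v = v"
      using S(2) \<alpha>(1) by (simp add: determining_set_def)
    then show ?thesis
      using \<alpha>(2) w by (auto simp: pverts_gen_mycielskian split: myc_vertex.splits)
  qed
  have "determining_set ?M T"
    using TM rigid by (auto simp: determining_set_def)
  then have det: "det_number ?M = k"
    using det_number_le[OF finT] cardT det_number_le_gen_mycielskian[OF G, of t] assms(4) by force
  define c where "c x = (if x \<in> T then 1 else 0 :: nat)" for x
  have class1: "color_class ?M c 1 = T"
    using TM by (auto simp: color_class_def c_def)
  have c: "distinguishing_coloring ?M 2 c"
    unfolding distinguishing_coloring_def
  proof (intro conjI allI impI)
    fix f assume f: "automorphism ?M f \<and> (\<forall>i<2. f ` color_class ?M c i = color_class ?M c i)"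
    then have "f ` color_class ?M c 1 = color_class ?M c 1"
      by (meson one_less_numeral_iff semiring_norm(76))
    then show "\<forall>x\<in>pverts ?M. f x = x"
      using f rigid[of f] unfolding class1 by blast
  qed (simp add: c_def)
  have dist: "dist_number ?M = 2"
    unfolding dist_number_def
  proof (rule Least_equality)
    fix d assume "\<exists>c. distinguishing_coloring ?M d c"
    then obtain c' where c': "distinguishing_coloring ?M d c'" ..
    show "2 \<le> d"
    proof (rule ccontr)
      assume "\<not> 2 \<le> d"
      then have d: "d < 2" by simp
      have lt: "\<forall>x\<in>pverts ?M. c' x < d"
        using c' by (simp add: distinguishing_coloring_def)
      \<comment> \<open>With at most one colour, every automorphism preserves all classes. The
        identity would then be the only automorphism and the empty set determining, against
        \<open>k \<ge> 2\<close>.\<close>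
      have "color_class ?M c' i = pverts ?M" if "i < d" for i
        using d that lt by (auto simp: color_class_def less_2_cases_iff)
      then have "determining_set ?M {}"
        using c' by (auto simp: distinguishing_coloring_def determining_set_def automorphism_def
            bij_betw_def)
      then show False
        using det_number_le[of "{}" ?M] det assms(5) by simp
    qed
  qed (use c in blast)
  have class_ge: "k \<le> card (color_class ?M c' i)"
    if "distinguishing_coloring ?M 2 c'" "i < 2" for c' i
  proof -
    have "finite (color_class ?M c' i)"
      using finite_pverts[OF M] by (simp add: color_class_def)
    then show ?thesis
      using det_number_le determining_color_class[OF that] det by metis
  qed
  have "dist_cost ?M = k"
    unfolding dist_cost_def
  proof (rule Least_equality)
    \<comment> \<open>Class 1 is \<open>T\<close>, of size \<open>k\<close>. Class 0 has at least
      \<open>k\<close> elements by \<open>class_ge\<close>, so the minimum is \<open>k\<close>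
      without counting the vertices.\<close>
    show "\<exists>c. distinguishing_coloring ?M 2 c \<and>
        k = min (card (color_class ?M c 0)) (card (color_class ?M c 1))"
      using c class_ge[OF c, of 0] class1 cardT by (intro exI[of _ c]) simp
  qed (use class_ge in auto)
  then show ?thesis
    using det dist by simp
qed

end
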